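(* Let $p,q\ge 1$ and $1\le r\le p$ be integers. Every surjective linear self map of $D^r_{p,q}$ can be represented by a matrix $M\in M_{p+q}$ satisfying $$M^H H_{p,q} M = H_{p,q}.$$ In particular, every surjective linear self map of $D^r_{p,q}$ is an automorphism of $D^r_{p,q}$.
   Context: $M_n$ is the set of $n\times n$ complex matrices and $\cdot^H$ is the Hermitian (conjugate) transpose. $H_{p,q}=\begin{pmatrix}I_p&0\\0&-I_q\end{pmatrix}$ is the standard Hermitian form of signature $(p,q)$ on $\mathbb C^{p+q}$. For $1\le r\le p$, the generalized type-I domain $D^r_{p,q}\subset Gr(r,\mathbb C^{p+q})$ is the set of $r$-dimensional complex linear subspaces ($r$-planes) of $\mathbb C^{p+q}$ on which $H_{p,q}$ is positive definite. A matrix $M\in M_{p+q}$ acts on column vectors by $z\mapsto Mz$. If the kernel of $M$ is negative semi-definite with respect to $H_{p,q}$ (equivalently, $M$ maps every positive definite $r$-plane onto an $r$-plane), $M$ induces a holomorphic map $D^r_{p,q}\to Gr(r,\mathbb C^{p+q})$, $P\mapsto M(P)$. A self map of $D^r_{p,q}$ is called a linear self map if it is induced in this way by some $M\in M_{p+q}$; any such $M$ is called a matrix representation of the linear self map (and is said to represent it). An automorphism is a biholomorphic self map. *)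

theory Defs
  imports "HOL-Analysis.Analysis"
begin

text \<open>
  The space of column vectors of length \<open>p + q\<close> is \<open>complex ^ ('p + 'q)\<close> with
  \<open>p = CARD('p)\<close> and \<open>q = CARD('q)\<close>; the \<open>Inl\<close> coordinates are the first \<open>p\<close> ones.
  Types are nonempty, so \<open>p, q \<ge> 1\<close> holds automatically.
\<close>

section \<open>The Hermitian form and the generalized type-I domain\<close>

definition hermitian_transpose :: "complex ^ 'n ^ 'm \<Rightarrow> complex ^ 'm ^ 'n" where
  "hermitian_transpose M = map_matrix cnj (transpose M)"

definition Hpq :: "complex ^ ('p::finite + 'q::finite) ^ ('p + 'q)" where
  "Hpq = (\<chi> i j. if i = j then (case i of Inl _ \<Rightarrow> 1 | Inr _ \<Rightarrow> - 1) else 0)"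

text \<open>\<open>z\<^sup>H H z\<close>; this number is real, so its sign is that of its real part.\<close>

definition herm_sq :: "complex ^ ('p::finite + 'q::finite) \<Rightarrow> real" where
  "herm_sq z = Re (\<Sum>i\<in>UNIV. cnj (z $ i) * (Hpq *v z) $ i)"

definition Grassmannian :: "nat \<Rightarrow> (complex ^ 'n) set set" where
  "Grassmannian r = {P. vec.subspace P \<and> vec.dim P = r}"

definition Dpq :: "nat \<Rightarrow> (complex ^ ('p::finite + 'q::finite)) set set" where
  "Dpq r = {P \<in> Grassmannian r. \<forall>z\<in>P. z \<noteq> 0 \<longrightarrow> herm_sq z > 0}"

section \<open>Linear self maps\<close>

text \<open>
  Only the values of \<open>f\<close> on the domain matter. The condition on the kernel of \<open>M\<close> says that it
  is negative semi-definite.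
\<close>

definition represents ::
  "nat \<Rightarrow> complex ^ ('p::finite + 'q::finite) ^ ('p + 'q)
    \<Rightarrow> ((complex ^ ('p + 'q)) set \<Rightarrow> (complex ^ ('p + 'q)) set) \<Rightarrow> bool" where
  "represents r M f \<longleftrightarrow>
     (\<forall>z. M *v z = 0 \<longrightarrow> herm_sq z \<le> 0) \<and> (\<forall>P\<in>Dpq r. f P = (*v) M ` P)"

definition linear_self_map ::
  "nat \<Rightarrow> ((complex ^ ('p::finite + 'q::finite)) set \<Rightarrow> (complex ^ ('p + 'q)) set) \<Rightarrow> bool" where
  "linear_self_map r f \<longleftrightarrow> f ` Dpq r \<subseteq> Dpq r \<and> (\<exists>M. represents r M f)"

section \<open>Holomorphic maps between subsets of Grassmannians\<close>

text \<open>
  The standard affine charts: for an \<open>r\<close>-element set \<open>J\<close> of coordinates, the planes projecting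
  isomorphically onto the coordinates in \<open>J\<close> are the graphs of the linear maps from the
  \<open>J\<close>-coordinates to the remaining ones. The \<open>(n - r) \<times> r\<close> matrix of such a linear map is
  encoded as a vector indexed by all pairs, which vanishes at the pairs outside \<open>(- J) \<times> J\<close>.
\<close>

definition chart_space :: "'n set \<Rightarrow> (complex ^ ('n::finite \<times> 'n)) set" where
  "chart_space J = {Z. \<forall>i j. (i, j) \<notin> (- J) \<times> J \<longrightarrow> Z $ (i, j) = 0}"

definition graph_plane :: "'n set \<Rightarrow> complex ^ ('n::finite \<times> 'n) \<Rightarrow> (complex ^ 'n) set" where
  "graph_plane J Z = {z. \<forall>i\<in>- J. z $ i = (\<Sum>j\<in>J. Z $ (i, j) * z $ j)}"

definition gr_chart :: "'n set \<Rightarrow> (complex ^ 'n) set \<Rightarrow> complex ^ ('n::finite \<times> 'n)" where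
  "gr_chart J = the_inv_into (chart_space J) (graph_plane J)"

lemma inj_on_graph_plane:
  fixes J :: "'n::finite set"
  shows "inj_on (graph_plane J) (chart_space J)"
proof (rule inj_onI)
  fix Z W :: "complex ^ ('n \<times> 'n)"
  assume Z: "Z \<in> chart_space J" and W: "W \<in> chart_space J"
    and eq: "graph_plane J Z = graph_plane J W"
  have "Z $ (i, j) = W $ (i, j)" for i j
  proof (cases "i \<in> - J \<and> j \<in> J")
    case True
    define z :: "complex ^ 'n" where
      "z = (\<chi> k. if k \<in> J then (if k = j then 1 else 0) else Z $ (k, j))"
    have s: "(\<Sum>k\<in>J. X $ (l, k) * z $ k) = X $ (l, j)" for X :: "complex ^ ('n \<times> 'n)" and l
    proof -
      have "(\<Sum>k\<in>J. X $ (l, k) * z $ k) = (\<Sum>k\<in>J. if k = j then X $ (l, k) else 0)"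
        by (intro sum.cong) (auto simp: z_def)
      then show ?thesis using True by simp
    qed
    have "z \<in> graph_plane J Z"
      unfolding graph_plane_def by (simp add: s) (simp add: z_def)
    then have "z \<in> graph_plane J W" by (simp only: eq)
    then have "z $ i = W $ (i, j)"
      using True by (simp add: graph_plane_def s)
    then show ?thesis using True by (simp add: z_def)
  next
    case False
    then show ?thesis using Z W by (auto simp: chart_space_def)
  qed
  then show "Z = W" by (simp add: vec_eq_iff)
qed

text \<open>
  Holomorphy in several variables: Frechet differentiability with a complex-linear derivative.
  It is used for \<open>U\<close> open in a complex subspace such as \<open>chart_space J\<close>, where it amounts to
  complex differentiability on that subspace.
\<close>

definition multi_holomorphic_on ::
  "(complex ^ 'm \<Rightarrow> complex ^ 'n) \<Rightarrow> (complex ^ 'm) set \<Rightarrow> bool" where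
  "multi_holomorphic_on F U \<longleftrightarrow>
     (\<forall>Z\<in>U. \<exists>L. (F has_derivative L) (at Z within U) \<and> Vector_Spaces.linear (*s) (*s) L)"

text \<open>
  A map is holomorphic on a set of \<open>r\<close>-planes (necessarily an open one) if, near each point, it
  is holomorphic when read in charts of the source and the target.
\<close>

definition gr_holomorphic_on ::
  "nat \<Rightarrow> ((complex ^ 'n::finite) set \<Rightarrow> (complex ^ 'n) set) \<Rightarrow> (complex ^ 'n) set set \<Rightarrow> bool" where
  "gr_holomorphic_on r f D \<longleftrightarrow>
     (\<forall>P\<in>D. \<exists>J K U.
        card J = r \<and> card K = r \<and>
        openin (top_of_set (chart_space J)) U \<and>
        P \<in> graph_plane J ` U \<and> graph_plane J ` U \<subseteq> D \<and>
        f ` graph_plane J ` U \<subseteq> graph_plane K ` chart_space K \<and>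
        multi_holomorphic_on (gr_chart K \<circ> f \<circ> graph_plane J) U)"

definition gr_automorphism ::
  "nat \<Rightarrow> ((complex ^ 'n::finite) set \<Rightarrow> (complex ^ 'n) set) \<Rightarrow> (complex ^ 'n) set set \<Rightarrow> bool" where
  "gr_automorphism r f D \<longleftrightarrow>
     bij_betw f D D \<and> gr_holomorphic_on r f D \<and> gr_holomorphic_on r (inv_into D f) D"

end

theory Submission
  imports Defs
begin

text \<open>
  Every positive vector lies in a positive \<open>r\<close>-plane, so surjectivity of the self map forces \<open>M\<close> to
  be invertible and to satisfy \<open>H(z) > 0 \<longleftrightarrow> H(Mz) > 0\<close>. Two real quadratic forms with the same
  positive vectors, the first one indefinite, are proportional: the second one vanishes on null
  vectors of the first by continuity, and when \<open>H(e)\<close> and \<open>H(z)\<close> have opposite signs the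
  line \<open>z + t e\<close> has two null vectors, which determine both forms along it up to a factor.
  Hence \<open>M\<^sup>H H M = c H\<close> with \<open>c > 0\<close>, and \<open>M\<close> can be rescaled. In the affine charts the map
  and its inverse are given by rational functions, by Cramer's rule.
\<close>

section \<open>Quadratic forms with the same positive vectors\<close>

text \<open>The sign condition makes the discriminant \<open>b\<^sup>2 - a * c\<close> positive, so
  the first polynomial has two distinct real roots. A polynomial of degree at most 2 that vanishes
  at both is a multiple of the first one.\<close>

lemma opposite_signs_proportional:
  fixes a b c a' b' c' :: real
  assumes "a * c < 0"
    and root: "\<And>t. c + 2 * b * t + a * t\<^sup>2 = 0 \<Longrightarrow> c' + 2 * b' * t + a' * t\<^sup>2 = 0"
  shows "c' * a = a' * c"
proof -
  define s where "s = sqrt (b\<^sup>2 - a * c)"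
  have "b\<^sup>2 - a * c > 0"
    using assms(1) by (smt (verit) zero_le_power2)
  then have s: "s\<^sup>2 = b\<^sup>2 - a * c" "s \<noteq> 0"
    by (auto simp: s_def)
  have "a \<noteq> 0"
    using assms(1) by auto
  \<comment> \<open>The parameter \<open>u\<close> stands for both \<open>s\<close> and
    \<open>- s\<close>, so that the two roots are treated at once.\<close>
  have r: "c' + 2 * b' * ((- b + u) / a) + a' * ((- b + u) / a)\<^sup>2 = 0" if "u\<^sup>2 = s\<^sup>2" for u
  proof (rule root)
    have "(c + 2 * b * ((- b + u) / a) + a * ((- b + u) / a)\<^sup>2) * a = a * c - b\<^sup>2 + u\<^sup>2"
      using \<open>a \<noteq> 0\<close> by (simp add: field_simps power2_eq_square)
    then show "c + 2 * b * ((- b + u) / a) + a * ((- b + u) / a)\<^sup>2 = 0"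
      using that s(1) \<open>a \<noteq> 0\<close> by auto
  qed
  have q: "c' * a\<^sup>2 + 2 * b' * a * (u - b) + a' * (u - b)\<^sup>2 = 0" if "u\<^sup>2 = s\<^sup>2" for u
  proof -
    have "(c' + 2 * b' * ((- b + u) / a) + a' * ((- b + u) / a)\<^sup>2) * a\<^sup>2
        = c' * a\<^sup>2 + 2 * b' * a * (u - b) + a' * (u - b)\<^sup>2"
      using \<open>a \<noteq> 0\<close> by (simp add: field_simps power2_eq_square)
    then show ?thesis
      using r[OF that] by simp
  qed
  have q1: "c' * a\<^sup>2 + 2 * b' * a * (s - b) + a' * (s - b)\<^sup>2 = 0"
    and q2: "c' * a\<^sup>2 + 2 * b' * a * (- s - b) + a' * (- s - b)\<^sup>2 = 0"
    using q[of s] q[of "- s"] by auto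
  \<comment> \<open>This is the difference of \<open>q1\<close> and \<open>q2\<close>; as
    \<open>s\<close> is nonzero, it makes the linear coefficients proportional. Putting that back
    into \<open>q1\<close> leaves the constant terms.\<close>
  have "4 * s * (b' * a - a' * b) = 0"
    using q1 q2 by algebra
  then have ba: "b' * a = a' * b"
    using s(2) by simp
  have "c' * a\<^sup>2 + 2 * (a' * b) * (s - b) + a' * (s - b)\<^sup>2 = 0"
    using q1 ba by algebra
  then have "c' * a\<^sup>2 + a' * (s\<^sup>2 - b\<^sup>2) = 0"
    by (simp add: algebra_simps power2_eq_square)
  then have "a * (c' * a) = a * (a' * c)"
    using s(1) by algebra
  then show ?thesis
    using \<open>a \<noteq> 0\<close> by simp
qed

text \<open>A real quadratic form is encoded by its self-adjoint operator, as
  \<open>x \<bullet> S x\<close>. Complex vector spaces are viewed as real ones here, so that lines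
  have a real parameter and sign and limit arguments apply.\<close>

locale self_adjoint =
  fixes S :: "'a::real_inner \<Rightarrow> 'a"
  assumes linear: "linear S"
    and adjoint: "x \<bullet> S y = S x \<bullet> y"
begin

lemma quad_add:
  "(z + t *\<^sub>R e) \<bullet> S (z + t *\<^sub>R e) = z \<bullet> S z + 2 * (z \<bullet> S e) * t + (e \<bullet> S e) * t\<^sup>2"
proof -
  have "e \<bullet> S z = z \<bullet> S e"
    using adjoint[of e z] by (simp add: inner_commute)
  then show ?thesis
    by (simp add: linear_add[OF linear] linear_scale[OF linear] inner_simps
        power2_eq_square algebra_simps)
qed

text \<open>Polarization: expanding the form at \<open>y + x\<close> leaves only the cross term
  \<open>2 * (y \<bullet> S x)\<close>.\<close>

lemma quad_eq_0_imp:
  assumes "\<And>x. x \<bullet> S x = 0"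
  shows "S x = 0"
proof -
  have "y \<bullet> S x = 0" for y
    using quad_add[of y 1 x] by (simp add: assms)
  then show ?thesis
    using inner_eq_zero_iff by blast
qed

end

lemma same_positive_cone_imp_proportional:
  fixes S T :: "'a::real_inner \<Rightarrow> 'a"
  assumes "self_adjoint S" "self_adjoint T"
    and e: "e \<bullet> S e > 0" and d: "d \<bullet> S d < 0"
    and pos: "\<And>z. z \<bullet> S z > 0 \<longleftrightarrow> z \<bullet> T z > 0"
  obtains c where "c > 0" "\<And>x. T x = c *\<^sub>R S x"
proof -
  interpret S: self_adjoint S by fact
  interpret T: self_adjoint T by fact
  have null: "z \<bullet> T z = 0" if z: "z \<bullet> S z = 0" for z
  proof (rule antisym)
    \<comment> \<open>A null vector of \<open>S\<close> is not positive for \<open>S\<close>, hence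
      not for \<open>T\<close>.\<close>
    show "z \<bullet> T z \<le> 0"
      using pos[of z] z by auto
    obtain u where u: "u \<bullet> S u > 0" "z \<bullet> S u \<ge> 0"
    proof (cases "z \<bullet> S e \<ge> 0")
      case True
      then show ?thesis using e that by blast
    next
      case False
      then show ?thesis using e that[of "- e"] by (simp add: linear_neg[OF S.linear])
    qed
    \<comment> \<open>The sign of \<open>u\<close> makes the cross term of \<open>S\<close>
      nonnegative, so the whole open ray \<open>z + t u\<close> is positive for \<open>S\<close>,
      hence for \<open>T\<close>. The lower bound at \<open>z\<close> follows as \<open>t\<close>
      tends to 0.\<close>
    have ge: "z \<bullet> T z + 2 * (z \<bullet> T u) * t + (u \<bullet> T u) * t\<^sup>2 \<ge> 0" if "t > 0" for t
    proof -
      have "(u \<bullet> S u) * t\<^sup>2 > 0" "2 * (z \<bullet> S u) * t \<ge> 0"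
        using u that by simp_all
      then have "(z + t *\<^sub>R u) \<bullet> S (z + t *\<^sub>R u) > 0"
        unfolding S.quad_add z by linarith
      then show ?thesis
        using pos T.quad_add by (metis less_imp_le)
    qed
    have "((\<lambda>t. z \<bullet> T z + 2 * (z \<bullet> T u) * t + (u \<bullet> T u) * t\<^sup>2)
        \<longlongrightarrow> z \<bullet> T z + 2 * (z \<bullet> T u) * 0 + (u \<bullet> T u) * 0\<^sup>2) (at_right 0)"
      by (intro tendsto_intros)
    moreover have "\<forall>\<^sub>F t in at_right 0. z \<bullet> T z + 2 * (z \<bullet> T u) * t + (u \<bullet> T u) * t\<^sup>2 \<ge> 0"
      using eventually_at_right_less by eventually_elim (rule ge)
    ultimately have "z \<bullet> T z + 2 * (z \<bullet> T u) * 0 + (u \<bullet> T u) * 0\<^sup>2 \<ge> 0"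
      by (rule tendsto_lowerbound) simp
    then show "0 \<le> z \<bullet> T z" by simp
  qed
  \<comment> \<open>The two polynomials are the forms along \<open>z + t u\<close>; by
    \<open>null\<close>, roots of the first are roots of the second.\<close>
  have ratio: "(z \<bullet> T z) * (u \<bullet> S u) = (u \<bullet> T u) * (z \<bullet> S z)"
    if "(u \<bullet> S u) * (z \<bullet> S z) < 0" for z u
    using that null S.quad_add T.quad_add
    by (intro opposite_signs_proportional[where b = "z \<bullet> S u" and b' = "z \<bullet> T u"]) metis+
  define c where "c = (e \<bullet> T e) / (e \<bullet> S e)"
  have "c > 0"
    using e pos by (simp add: c_def)
  have neg: "z \<bullet> T z = c * (z \<bullet> S z)" if "z \<bullet> S z < 0" for z
  proof -
    have "(e \<bullet> S e) * (z \<bullet> S z) < 0"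
      using e that by (simp add: mult_pos_neg)
    then show ?thesis
      using ratio[of e z] e by (simp add: c_def field_simps)
  qed
  have eq: "z \<bullet> T z = c * (z \<bullet> S z)" for z
  proof -
    consider "z \<bullet> S z < 0" | "z \<bullet> S z = 0" | "z \<bullet> S z > 0" by linarith
    then show ?thesis
    proof cases
      case 3
      \<comment> \<open>\<open>ratio\<close> only compares vectors of opposite sign, so a positive
        \<open>z\<close> is compared with \<open>e\<close> by way of \<open>d\<close>, whose factor
        is already known to be \<open>c\<close>.\<close>
      then have "(d \<bullet> S d) * (z \<bullet> S z) < 0"
        using d by (simp add: mult_neg_pos)
      then have "(z \<bullet> T z) * (d \<bullet> S d) = c * (z \<bullet> S z) * (d \<bullet> S d)"
        using ratio[of d z] neg[OF d] by (simp add: mult_ac)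
      then show ?thesis using d by simp
    qed (use neg null in auto)
  qed
  interpret D: self_adjoint "\<lambda>x. T x - c *\<^sub>R S x"
  proof (rule self_adjoint.intro)
    show "linear (\<lambda>x. T x - c *\<^sub>R S x)"
      by (intro linear_compose_sub linear_compose_scale_right T.linear S.linear)
  qed (use T.adjoint S.adjoint in \<open>simp add: inner_simps\<close>)
  have "T x - c *\<^sub>R S x = 0" for x
    by (rule D.quad_eq_0_imp) (simp add: inner_diff_right eq)
  then show ?thesis
    using that \<open>c > 0\<close> by simp
qed

section \<open>The Hermitian form\<close>

lemma scaleR_eq_of_real_smult: "a *\<^sub>R x = complex_of_real a *s (x :: complex ^ 'n)"
  by (simp add: vec_eq_iff scaleR_conv_of_real[where 'a = complex])

lemma matrix_vector_mult_scaleR: "M *v (a *\<^sub>R x) = a *\<^sub>R (M *v (x :: complex ^ 'n::finite))"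
  by (simp add: scaleR_eq_of_real_smult vec.scale)

lemma linear_matrix_vector_mult: "linear ((*v) (M :: complex ^ 'n::finite ^ 'm))"
  by (rule linearI) (simp_all add: matrix_vector_right_distrib matrix_vector_mult_scaleR)

text \<open>The real inner product is the real part of the standard Hermitian product, so the
  Hermitian transpose is also the adjoint for it.\<close>

lemma inner_matrix_vector_mult:
  fixes M :: "complex ^ 'n::finite ^ 'm::finite"
  shows "(M *v x) \<bullet> y = x \<bullet> (hermitian_transpose M *v y)"
proof -
  have "(M *v x) \<bullet> y = (\<Sum>i\<in>UNIV. \<Sum>j\<in>UNIV. (M $ i $ j * x $ j) \<bullet> y $ i)"
    by (simp add: inner_vec_def matrix_vector_mult_def inner_sum_left)
  also have "\<dots> = (\<Sum>j\<in>UNIV. \<Sum>i\<in>UNIV. x $ j \<bullet> (cnj (M $ i $ j) * y $ i))"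
    by (subst sum.swap) (simp add: inner_complex_def algebra_simps)
  also have "\<dots> = x \<bullet> (hermitian_transpose M *v y)"
    by (simp add: inner_vec_def matrix_vector_mult_def inner_sum_right hermitian_transpose_def
        map_matrix_def transpose_def)
  finally show ?thesis .
qed

lemma herm_sq_eq_inner: "herm_sq z = z \<bullet> (Hpq *v z)"
  by (simp add: herm_sq_def inner_vec_def inner_complex_def)

lemma hermitian_transpose_Hpq: "hermitian_transpose Hpq = Hpq"
  by (auto simp: hermitian_transpose_def map_matrix_def transpose_def Hpq_def vec_eq_iff
      split: sum.split)

lemma Hpq_mult_nth: "(Hpq *v z) $ i = (case i of Inl _ \<Rightarrow> z $ i | Inr _ \<Rightarrow> - z $ i)"
  by (auto simp: Hpq_def matrix_vector_mult_def if_distrib[of "\<lambda>x. x * _"] split: sum.split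
      cong: if_cong)

lemma herm_sq_eq_sums:
  "herm_sq z = (\<Sum>a\<in>UNIV. (cmod (z $ Inl a))\<^sup>2) - (\<Sum>b\<in>UNIV. (cmod (z $ Inr b))\<^sup>2)"
proof -
  have "herm_sq z = (\<Sum>i\<in>UNIV <+> UNIV. z $ i \<bullet> (Hpq *v z) $ i)"
    by (simp add: herm_sq_eq_inner inner_vec_def)
  also have "\<dots> = (\<Sum>a\<in>UNIV. (cmod (z $ Inl a))\<^sup>2) - (\<Sum>b\<in>UNIV. (cmod (z $ Inr b))\<^sup>2)"
    by (subst sum.Plus)
      (simp_all add: Hpq_mult_nth sum_negf dot_square_norm)
  finally show ?thesis .
qed

lemma herm_sq_scaleR: "herm_sq (a *\<^sub>R z) = a\<^sup>2 * herm_sq z"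
  by (simp add: herm_sq_eq_inner matrix_vector_mult_scaleR power2_eq_square)

lemma self_adjoint_Hpq: "self_adjoint ((*v) Hpq)"
  by (rule self_adjoint.intro)
    (simp_all add: linear_matrix_vector_mult inner_matrix_vector_mult hermitian_transpose_Hpq)

lemma self_adjoint_congruence:
  "self_adjoint ((*v) (hermitian_transpose M ** Hpq ** M))"
proof (rule self_adjoint.intro)
  fix x y
  have "x \<bullet> ((hermitian_transpose M ** Hpq ** M) *v y) = (M *v x) \<bullet> (Hpq *v (M *v y))"
    by (simp add: inner_matrix_vector_mult matrix_vector_mul_assoc matrix_mul_assoc)
  also have "\<dots> = (Hpq *v (M *v x)) \<bullet> (M *v y)"
    by (simp add: inner_matrix_vector_mult[of Hpq] hermitian_transpose_Hpq)
  also have "\<dots> = (M *v y) \<bullet> (Hpq *v (M *v x))"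
    by (rule inner_commute)
  also have "\<dots> = y \<bullet> ((hermitian_transpose M ** Hpq ** M) *v x)"
    by (simp add: inner_matrix_vector_mult matrix_vector_mul_assoc matrix_mul_assoc)
  finally show "x \<bullet> ((hermitian_transpose M ** Hpq ** M) *v y)
      = ((hermitian_transpose M ** Hpq ** M) *v x) \<bullet> y"
    by (simp add: inner_commute)
qed (rule linear_matrix_vector_mult)

lemma inner_congruence:
  "z \<bullet> ((hermitian_transpose M ** Hpq ** M) *v z) = herm_sq (M *v z)"
  by (simp add: herm_sq_eq_inner inner_matrix_vector_mult matrix_vector_mul_assoc matrix_mul_assoc)

section \<open>Subspaces as graphs\<close>

definition coord_space :: "'n set \<Rightarrow> (complex ^ 'n::finite) set" where
  "coord_space J = {w. \<forall>i. i \<notin> J \<longrightarrow> w $ i = 0}"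

text \<open>This is the projection onto the graph plane along the coordinates outside
  \<open>J\<close>. The plane is therefore both its set of fixed points and its image, and on
  \<open>coord_space J\<close> it is a linear parametrization of the plane.\<close>

definition graph_matrix :: "'n set \<Rightarrow> complex ^ ('n::finite \<times> 'n) \<Rightarrow> complex ^ 'n ^ 'n" where
  "graph_matrix J Z =
    (\<chi> i j. if j \<in> J then if i \<in> J then if i = j then 1 else 0 else Z $ (i, j) else 0)"

lemma graph_matrix_mult_nth:
  "(graph_matrix J Z *v w) $ i = (if i \<in> J then w $ i else \<Sum>j\<in>J. Z $ (i, j) * w $ j)"
proof -
  have "(graph_matrix J Z *v w) $ i =
      (\<Sum>j\<in>J. (if i \<in> J then if i = j then 1 else 0 else Z $ (i, j)) * w $ j)"
    unfolding matrix_vector_mult_def graph_matrix_def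
    by (simp add: if_distrib[of "\<lambda>x. x * _"] sum.If_cases cong: if_cong)
  also have "\<dots> = (if i \<in> J then w $ i else \<Sum>j\<in>J. Z $ (i, j) * w $ j)"
    by (simp add: if_distrib[of "\<lambda>x. x * _"] cong: if_cong)
  finally show ?thesis .
qed

lemma mem_graph_plane_iff: "z \<in> graph_plane J Z \<longleftrightarrow> graph_matrix J Z *v z = z"
  by (auto simp: graph_plane_def vec_eq_iff graph_matrix_mult_nth)

lemma subspace_graph_plane: "vec.subspace (graph_plane J Z)"
  by (auto simp: vec.subspace_def mem_graph_plane_iff matrix_vector_right_distrib
      vec.scale)

lemma graph_plane_eq_image: "graph_plane J Z = (*v) (graph_matrix J Z) ` coord_space J"
proof (intro equalityI subsetI)
  fix z assume "z \<in> graph_plane J Z"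
  then have "z = graph_matrix J Z *v (\<chi> i. if i \<in> J then z $ i else 0)"
    by (auto simp: graph_plane_def vec_eq_iff graph_matrix_mult_nth intro!: sum.cong)
  then show "z \<in> (*v) (graph_matrix J Z) ` coord_space J"
    by (rule image_eqI) (simp add: coord_space_def)
next
  fix z assume "z \<in> (*v) (graph_matrix J Z) ` coord_space J"
  then show "z \<in> graph_plane J Z"
    by (auto simp: graph_plane_def graph_matrix_mult_nth)
qed

lemma graph_matrix_mult_eq_0:
  assumes "w \<in> coord_space J" "graph_matrix J Z *v w = 0"
  shows "w = 0"
proof -
  have "w $ i = 0" for i
    using assms graph_matrix_mult_nth[of J Z w i] by (cases "i \<in> J") (auto simp: coord_space_def)
  then show ?thesis
    by (simp add: vec_eq_iff)
qed

lemma subspace_coord_space: "vec.subspace (coord_space J)"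
  by (simp add: vec.subspace_def coord_space_def)

lemma dim_graph_plane: "vec.dim (graph_plane J Z) = card J"
proof -
  have "inj_on ((*v) (graph_matrix J Z)) (vec.span (coord_space J))"
  proof (rule inj_onI)
    fix v w
    assume vw: "v \<in> vec.span (coord_space J)" "w \<in> vec.span (coord_space J)"
      and eq: "graph_matrix J Z *v v = graph_matrix J Z *v w"
    have "v - w \<in> coord_space J"
      using vw by (metis subspace_coord_space vec.span_eq_iff vec.subspace_diff)
    moreover have "graph_matrix J Z *v (v - w) = 0"
      using eq by (simp add: matrix_vector_mult_diff_distrib)
    ultimately show "v = w"
      using graph_matrix_mult_eq_0 by fastforce
  qed
  then have "vec.dim (graph_plane J Z) = vec.dim (coord_space J)"
    unfolding graph_plane_eq_image by (rule vec.dim_image_eq[OF matrix_vector_mul_linear_gen])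
  then show ?thesis
    by (simp add: coord_space_def dim_substandard_cart)
qed

lemma graph_plane_eq_subspace:
  assumes "vec.subspace P" "vec.dim P = card J" "P \<subseteq> graph_plane J Z"
  shows "P = graph_plane J Z"
  using assms subspace_graph_plane by (intro vec.subspace_dim_equal) (auto simp: dim_graph_plane)

lemma gr_chart_graph_plane: "Z \<in> chart_space J \<Longrightarrow> gr_chart J (graph_plane J Z) = Z"
  unfolding gr_chart_def by (rule the_inv_into_f_f[OF inj_on_graph_plane])

lemma subspace_is_graph_plane:
  fixes P :: "(complex ^ 'n::finite) set"
  assumes P: "vec.subspace P"
  obtains J Z where "Z \<in> chart_space J" "P = graph_plane J Z" "card J = vec.dim P"
proof -
  \<comment> \<open>\<open>J\<close> is a smallest set of coordinates that determines the points of \<open>P\<close>.\<close>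
  define determines where "determines J \<longleftrightarrow> (\<forall>z\<in>P. (\<forall>j\<in>J. z $ j = 0) \<longrightarrow> z = 0)" for J
  have "determines UNIV"
    by (auto simp: determines_def vec_eq_iff)
  then obtain J where J: "determines J" and min: "\<And>I. determines I \<Longrightarrow> card J \<le> card I"
    using ex_has_least_nat[of determines UNIV card] by metis
  \<comment> \<open>By minimality \<open>J - {j}\<close> misses some nonzero vector of
    \<open>P\<close>; its \<open>j\<close>-th coordinate is nonzero because \<open>J\<close>
    determines it, and can be scaled to 1. This yields a basis \<open>b\<close> of \<open>P\<close>
    dual to the coordinates in \<open>J\<close>.\<close>
  have "\<exists>z\<in>P. z $ j = 1 \<and> (\<forall>i\<in>J - {j}. z $ i = 0)" if "j \<in> J" for j
  proof -
    have "\<not> determines (J - {j})"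
      using min[of "J - {j}"] card_Diff1_less[OF _ that] by fastforce
    then obtain z where z: "z \<in> P" "\<forall>i\<in>J - {j}. z $ i = 0" "z \<noteq> 0"
      by (auto simp: determines_def)
    then have "z $ j \<noteq> 0"
      using J by (auto simp: determines_def)
    then show ?thesis
      using z by (intro bexI[of _ "inverse (z $ j) *s z"] vec.subspace_scale[OF P]) auto
  qed
  then obtain b where b: "\<And>j. j \<in> J \<Longrightarrow> b j \<in> P" "\<And>j. j \<in> J \<Longrightarrow> b j $ j = 1"
    "\<And>i j. j \<in> J \<Longrightarrow> i \<in> J \<Longrightarrow> i \<noteq> j \<Longrightarrow> b j $ i = 0"
    by (metis DiffI singletonD)
  define Z :: "complex ^ ('n \<times> 'n)" where
    "Z = (\<chi> p. if fst p \<notin> J \<and> snd p \<in> J then b (snd p) $ fst p else 0)"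
  have comb: "graph_matrix J Z *v z = (\<Sum>j\<in>J. z $ j *s b j)" for z
  proof -
    have "(\<Sum>j\<in>J. z $ j * b j $ i) = (\<Sum>j\<in>J. if j = i then z $ j else 0)" if "i \<in> J" for i
      using that b by (intro sum.cong) auto
    then show ?thesis
      by (auto simp: vec_eq_iff graph_matrix_mult_nth Z_def mult.commute intro!: sum.cong)
  qed
  have comb_in: "(\<Sum>j\<in>J. z $ j *s b j) \<in> P" for z :: "complex ^ 'n"
    by (intro vec.subspace_sum[OF P] vec.subspace_scale[OF P] b)
  have "P = graph_plane J Z"
  proof (intro equalityI subsetI)
    fix z assume "z \<in> P"
    \<comment> \<open>This difference lies in \<open>P\<close> and vanishes on \<open>J\<close>, so
      it is 0 because \<open>J\<close> determines points of \<open>P\<close>.\<close>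
    then have "graph_matrix J Z *v z - z \<in> P"
      using comb_in vec.subspace_diff[OF P] by (simp add: comb)
    moreover have "(graph_matrix J Z *v z - z) $ i = 0" if "i \<in> J" for i
      using that by (simp add: graph_matrix_mult_nth)
    ultimately show "z \<in> graph_plane J Z"
      using J by (auto simp: determines_def mem_graph_plane_iff)
  next
    fix z assume "z \<in> graph_plane J Z"
    then show "z \<in> P"
      using comb_in[of z] by (simp add: mem_graph_plane_iff comb)
  qed
  moreover have "Z \<in> chart_space J"
    by (auto simp: chart_space_def Z_def)
  ultimately show ?thesis
    using that dim_graph_plane by metis
qed

section \<open>Holomorphy of linear maps in charts\<close>

text \<open>The scalar counterpart of \<open>multi_holomorphic_on\<close>. A derivative is already
  real linear, so complex homogeneity makes it complex linear.\<close>

definition complex_differentiable_within ::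
  "(complex ^ 'm \<Rightarrow> complex) \<Rightarrow> complex ^ 'm::finite \<Rightarrow> (complex ^ 'm) set \<Rightarrow> bool" where
  "complex_differentiable_within F Z U \<longleftrightarrow>
    (\<exists>L. (F has_derivative L) (at Z within U) \<and> (\<forall>c x. L (c *s x) = c * L x))"

lemma complex_differentiable_const [intro]: "complex_differentiable_within (\<lambda>_. c) Z U"
  unfolding complex_differentiable_within_def by (intro exI[of _ "\<lambda>_. 0"]) auto

lemma complex_differentiable_nth [intro]: "complex_differentiable_within (\<lambda>Z. Z $ i) Z U"
  unfolding complex_differentiable_within_def
  by (intro exI[of _ "\<lambda>h. h $ i"])
    (auto intro: bounded_linear_imp_has_derivative bounded_linear_vec_nth)

lemma complex_differentiable_add:
  assumes "complex_differentiable_within F Z U" "complex_differentiable_within G Z U"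
  shows "complex_differentiable_within (\<lambda>Z. F Z + G Z) Z U"
proof -
  from assms obtain K L where
    "(F has_derivative K) (at Z within U)" "\<And>c x. K (c *s x) = c * K x"
    "(G has_derivative L) (at Z within U)" "\<And>c x. L (c *s x) = c * L x"
    unfolding complex_differentiable_within_def by blast
  then show ?thesis
    unfolding complex_differentiable_within_def
    by (intro exI[of _ "\<lambda>h. K h + L h"]) (auto intro: has_derivative_add simp: algebra_simps)
qed

lemma complex_differentiable_mult:
  assumes "complex_differentiable_within F Z U" "complex_differentiable_within G Z U"
  shows "complex_differentiable_within (\<lambda>Z. F Z * G Z) Z U"
proof -
  from assms obtain K L where
    "(F has_derivative K) (at Z within U)" "\<And>c x. K (c *s x) = c * K x"
    "(G has_derivative L) (at Z within U)" "\<And>c x. L (c *s x) = c * L x"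
    unfolding complex_differentiable_within_def by blast
  then show ?thesis
    unfolding complex_differentiable_within_def
    by (intro exI[of _ "\<lambda>h. F Z * L h + K h * G Z"])
      (intro conjI has_derivative_mult, auto simp: algebra_simps)
qed

lemma complex_differentiable_inverse:
  assumes "complex_differentiable_within F Z U" "F Z \<noteq> 0"
  shows "complex_differentiable_within (\<lambda>Z. inverse (F Z)) Z U"
proof -
  from assms obtain K where
    K: "(F has_derivative K) (at Z within U)" "\<And>c x. K (c *s x) = c * K x"
    unfolding complex_differentiable_within_def by blast
  show ?thesis
    unfolding complex_differentiable_within_def
    using Deriv.has_derivative_inverse[OF assms(2) K(1)]
    by (intro exI conjI) (auto simp: K(2) algebra_simps)
qed

lemma complex_differentiable_sum:
  assumes "\<And>i. i \<in> A \<Longrightarrow> complex_differentiable_within (F i) Z U"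
  shows "complex_differentiable_within (\<lambda>Z. \<Sum>i\<in>A. F i Z) Z U"
  using assms
  by (induction A rule: infinite_finite_induct) (auto intro: complex_differentiable_add)

lemma complex_differentiable_prod:
  assumes "\<And>i. i \<in> A \<Longrightarrow> complex_differentiable_within (F i) Z U"
  shows "complex_differentiable_within (\<lambda>Z. \<Prod>i\<in>A. F i Z) Z U"
  using assms
  by (induction A rule: infinite_finite_induct) (auto intro: complex_differentiable_mult)

lemma complex_differentiable_det:
  fixes A :: "complex ^ 'm::finite \<Rightarrow> complex ^ 'n::finite ^ 'n"
  assumes "\<And>i j. complex_differentiable_within (\<lambda>Z. A Z $ i $ j) Z U"
  shows "complex_differentiable_within (\<lambda>Z. det (A Z)) Z U"
  unfolding det_def
  by (intro complex_differentiable_sum complex_differentiable_mult complex_differentiable_prod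
      complex_differentiable_const assms)

lemma multi_holomorphic_onI:
  fixes F :: "complex ^ 'm::finite \<Rightarrow> complex ^ 'n::finite"
  assumes "\<And>Z i. Z \<in> U \<Longrightarrow> complex_differentiable_within (\<lambda>Z. F Z $ i) Z U"
  shows "multi_holomorphic_on F U"
  unfolding multi_holomorphic_on_def
proof
  fix Z assume "Z \<in> U"
  then obtain L where L: "\<And>i. ((\<lambda>Z. F Z $ i) has_derivative L i) (at Z within U)"
    "\<And>i c x. L i (c *s x) = c * L i x"
    using assms[of Z] unfolding complex_differentiable_within_def by metis
  have "(F has_derivative (\<lambda>h. \<chi> i. L i h)) (at Z within U)"
    by (subst has_derivative_componentwise_within)
      (auto simp: Basis_vec_def inner_axis intro!: has_derivative_inner_left L)
  moreover have "Vector_Spaces.linear (*s) (*s) (\<lambda>h. \<chi> i. L i h)"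
    by (auto simp: Vector_Spaces.linear_iff vec_eq_iff L vec.vector_space_axioms
        linear_add[OF has_derivative_linear[OF L(1)]])
  ultimately show "\<exists>L. (F has_derivative L) (at Z within U) \<and> Vector_Spaces.linear (*s) (*s) L"
    by blast
qed

lemma complex_differentiable_imp_continuous_on:
  assumes "\<And>Z. complex_differentiable_within F Z UNIV"
  shows "continuous_on UNIV F"
  using assms unfolding complex_differentiable_within_def
  by (metis continuous_at_imp_continuous_on has_derivative_continuous)

section \<open>Positivity and invertible matrices in the affine charts\<close>

lemma graph_plane_in_Dpq_iff:
  fixes J :: "('p::finite + 'q::finite) set"
  shows "graph_plane J Z \<in> Dpq (card J) \<longleftrightarrow>
    (\<forall>w\<in>coord_space J \<inter> sphere 0 1. herm_sq (graph_matrix J Z *v w) > 0)"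
proof
  assume D: "graph_plane J Z \<in> Dpq (card J)"
  show "\<forall>w\<in>coord_space J \<inter> sphere 0 1. herm_sq (graph_matrix J Z *v w) > 0"
  proof
    fix w :: "complex ^ ('p + 'q)" assume w: "w \<in> coord_space J \<inter> sphere 0 1"
    then have "graph_matrix J Z *v w \<noteq> 0"
      using graph_matrix_mult_eq_0 by fastforce
    moreover have "graph_matrix J Z *v w \<in> graph_plane J Z"
      using w by (auto simp: graph_plane_eq_image)
    ultimately show "herm_sq (graph_matrix J Z *v w) > 0"
      using D by (auto simp: Dpq_def)
  qed
next
  assume pos: "\<forall>w\<in>coord_space J \<inter> sphere 0 1. herm_sq (graph_matrix J Z *v w) > 0"
  have "herm_sq z > 0" if z: "z \<in> graph_plane J Z" "z \<noteq> 0" for z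
  proof -
    obtain w where w: "w \<in> coord_space J" "z = graph_matrix J Z *v w"
      using z by (auto simp: graph_plane_eq_image)
    then have "w \<noteq> 0"
      using z by auto
    then have "inverse (norm w) *\<^sub>R w \<in> coord_space J \<inter> sphere 0 1"
      using w by (simp add: coord_space_def)
    then have "herm_sq (graph_matrix J Z *v (inverse (norm w) *\<^sub>R w)) > 0"
      using pos by blast
    then show ?thesis
      by (simp add: matrix_vector_mult_scaleR herm_sq_scaleR w zero_less_mult_iff)
  qed
  then show "graph_plane J Z \<in> Dpq (card J)"
    by (simp add: Dpq_def Grassmannian_def subspace_graph_plane dim_graph_plane)
qed

text \<open>By homogeneity, positivity need only be tested on the unit sphere of
  \<open>coord_space J\<close>, which is compact and independent of \<open>Z\<close>. The complement
  is then the projection of a closed set along a compact factor, hence closed.\<close>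

lemma open_graph_plane_in_Dpq:
  fixes J :: "('p::finite + 'q::finite) set"
  shows "open {Z. graph_plane J Z \<in> Dpq (card J)}"
proof -
  let ?S = "coord_space J \<inter> sphere 0 1 :: (complex ^ ('p + 'q)) set"
  let ?T = "{p. herm_sq (graph_matrix J (snd p) *v fst p) \<le> 0}"
  have "closed (coord_space J)"
    unfolding coord_space_def
    by (intro closed_Collect_all closed_Collect_imp open_Collect_const closed_Collect_eq
        continuous_intros)
  then have "compact ?S"
    by (simp add: closed_Int_compact)
  moreover have "closed ?T"
  proof (rule closed_Collect_le)
    have "continuous_on UNIV (\<lambda>p. (graph_matrix J (snd p) *v fst p) $ i)" for i
      by (cases "i \<in> J") (auto simp: graph_matrix_mult_nth intro!: continuous_intros)
    then show "continuous_on UNIV (\<lambda>p. herm_sq (graph_matrix J (snd p) *v fst p))"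
      by (simp add: herm_sq_eq_sums continuous_intros)
  qed (rule continuous_on_const)
  ultimately have "closed {Z. \<exists>w. w \<in> ?S \<and> (w, Z) \<in> ?T}"
    by (rule closed_compact_projection)
  moreover have "{Z. \<exists>w. w \<in> ?S \<and> (w, Z) \<in> ?T} = - {Z. graph_plane J Z \<in> Dpq (card J)}"
    unfolding graph_plane_in_Dpq_iff Collect_neg_eq[symmetric] Ball_def by (simp add: not_less)
  ultimately show ?thesis
    by (simp add: closed_def)
qed

text \<open>Charts \<open>J\<close> at \<open>P\<close> and \<open>K\<close> at its image are fixed.
  Near \<open>P\<close> the chart coordinates of the image are quotients of determinants whose
  entries are affine functions of \<open>Z\<close>.\<close>

lemma gr_holomorphic_on_invertible:
  fixes M :: "complex ^ ('p::finite + 'q::finite) ^ ('p + 'q)"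
  assumes M: "inj ((*v) M)" and f: "\<And>P. P \<in> Dpq r \<Longrightarrow> f P = (*v) M ` P"
  shows "gr_holomorphic_on r f (Dpq r)"
  unfolding gr_holomorphic_on_def
proof
  fix P :: "(complex ^ ('p + 'q)) set" assume P: "P \<in> Dpq r"
  have dim_image: "vec.dim ((*v) M ` Q) = vec.dim Q" for Q
    by (rule vec.dim_image_eq[OF matrix_vector_mul_linear_gen]) (rule inj_on_subset[OF M subset_UNIV])
  have subspace_image: "vec.subspace ((*v) M ` Q)" if "vec.subspace Q" for Q
    using that by (rule vec.linear_subspace_image[OF matrix_vector_mul_linear_gen])
  have P': "vec.subspace P" "vec.dim P = r"
    using P by (auto simp: Dpq_def Grassmannian_def)
  obtain J Z\<^sub>0 where J: "Z\<^sub>0 \<in> chart_space J" "P = graph_plane J Z\<^sub>0" "card J = r"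
    using subspace_is_graph_plane[OF P'(1)] P'(2) by metis
  obtain K W\<^sub>0 where K: "(*v) M ` P = graph_plane K W\<^sub>0" "card K = r"
    using subspace_is_graph_plane[OF subspace_image[OF P'(1)]] P'(2) dim_image by metis
  \<comment> \<open>Relabelling the columns by \<open>\<tau>\<close> turns the minor with rows
    \<open>K\<close> and columns \<open>J\<close> into a square matrix indexed by
    \<open>K\<close>.\<close>
  obtain \<tau> where \<tau>: "bij_betw \<tau> K J"
    using J(3) K(2) by (metis finite_same_card_bij finite)
  define N where "N Z = M ** graph_matrix J Z" for Z
  have N_mult: "(N Z *v v) $ i = (\<Sum>k\<in>K. N Z $ i $ \<tau> k * v $ \<tau> k)" if "v \<in> coord_space J" for Z v i
  proof -
    have "(N Z *v v) $ i = (\<Sum>j\<in>J. N Z $ i $ j * v $ j)"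
      unfolding matrix_vector_mult_def using that
      by (auto simp: coord_space_def intro!: sum.mono_neutral_right)
    also have "\<dots> = (\<Sum>k\<in>K. N Z $ i $ \<tau> k * v $ \<tau> k)"
      by (rule sum.reindex_bij_betw[OF \<tau>, symmetric])
    finally show ?thesis .
  qed
  have image: "(*v) M ` graph_plane J Z = (*v) (N Z) ` coord_space J" for Z
    by (simp add: graph_plane_eq_image N_def image_image matrix_vector_mul_assoc)
  \<comment> \<open>The chart coordinates of the image plane express the rows of \<open>N Z\<close> outside \<open>K\<close> through
    the rows in \<open>K\<close>. This linear system is padded by an identity block to an \<open>n \<times> n\<close> one, with
    matrix \<open>A Z\<close>, so that Cramer's rule applies.\<close>
  define A where
    "A Z = (\<chi> k' k. if k' \<in> K \<and> k \<in> K then N Z $ k $ \<tau> k' else if k' = k then 1 else 0)" for Z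
  define b where "b Z i = (\<chi> k'. if k' \<in> K then N Z $ i $ \<tau> k' else 0)" for Z i
  define x where
    "x Z i = (\<chi> k. det (\<chi> a c. if c = k then b Z i $ a else A Z $ a $ c) / det (A Z))" for Z i
  define W :: "complex ^ (('p + 'q) \<times> ('p + 'q)) \<Rightarrow> complex ^ (('p + 'q) \<times> ('p + 'q))" where
    "W Z = (\<chi> p. if fst p \<notin> K \<and> snd p \<in> K then x Z (fst p) $ snd p else 0)" for Z
  \<comment> \<open>The first condition keeps the neighbourhood inside the domain, the second keeps
    the images inside the chart \<open>K\<close>.\<close>
  define U where
    "U = chart_space J \<inter> ({Z. graph_plane J Z \<in> Dpq r} \<inter> {Z. det (A Z) \<noteq> 0})"
  have W_chart: "W Z \<in> chart_space K" for Z
    by (auto simp: W_def chart_space_def)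
  have W_eq: "(*v) M ` graph_plane J Z = graph_plane K (W Z)" if Z: "det (A Z) \<noteq> 0" for Z
  \<comment> \<open>The dimensions agree, so an inclusion suffices.\<close>
  proof (rule graph_plane_eq_subspace)
    show "vec.subspace ((*v) M ` graph_plane J Z)"
      by (intro subspace_image subspace_graph_plane)
    show "vec.dim ((*v) M ` graph_plane J Z) = card K"
      by (simp add: dim_image dim_graph_plane J K)
    have row: "(\<Sum>k\<in>K. x Z i $ k * N Z $ k $ \<tau> k') = N Z $ i $ \<tau> k'" if k': "k' \<in> K" for i k'
    proof -
      have "A Z *v x Z i = b Z i"
        using cramer[OF Z] by (simp add: x_def)
      then have "(A Z *v x Z i) $ k' = N Z $ i $ \<tau> k'"
        using k' by (simp add: b_def)
      moreover have "(A Z *v x Z i) $ k' = (\<Sum>k\<in>K. A Z $ k' $ k * x Z i $ k)"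
        unfolding matrix_vector_mult_def vec_lambda_beta using k'
        by (intro sum.mono_neutral_right) (auto simp: A_def)
      ultimately show ?thesis
        using k' by (simp add: A_def mult.commute)
    qed
    show "(*v) M ` graph_plane J Z \<subseteq> graph_plane K (W Z)"
      unfolding image
    proof
      fix z assume "z \<in> (*v) (N Z) ` coord_space J"
      then obtain v where v: "v \<in> coord_space J" "z = N Z *v v" by blast
      have "(\<Sum>k\<in>K. W Z $ (i, k) * z $ k) = z $ i" if "i \<notin> K" for i
      proof -
        have "(\<Sum>k\<in>K. W Z $ (i, k) * z $ k)
            = (\<Sum>k\<in>K. \<Sum>k'\<in>K. x Z i $ k * N Z $ k $ \<tau> k' * v $ \<tau> k')"
          using that by (simp add: v N_mult W_def sum_distrib_left mult.assoc)
        also have "\<dots> = (\<Sum>k'\<in>K. (\<Sum>k\<in>K. x Z i $ k * N Z $ k $ \<tau> k') * v $ \<tau> k')"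
          by (subst sum.swap) (simp add: sum_distrib_right)
        also have "\<dots> = z $ i"
          by (simp add: v N_mult row)
        finally show ?thesis .
      qed
      then show "z \<in> graph_plane K (W Z)"
        by (simp add: graph_plane_def)
    qed
  qed
  \<comment> \<open>The identity block makes a kernel vector \<open>y\<close> of the transpose
    vanish outside \<open>K\<close>. Moved to \<open>J\<close> by \<open>\<tau>\<close>, it
    parametrizes a point of the image plane whose coordinates in \<open>K\<close> are 0; that plane
    is a graph over \<open>K\<close>, so the point is 0, and injectivity gives
    \<open>y = 0\<close>.\<close>
  have det_nz: "det (A Z\<^sub>0) \<noteq> 0"
  proof -
    have "y = 0" if y: "transpose (A Z\<^sub>0) *v y = 0" for y
    proof -
      have comp: "(\<Sum>k'\<in>UNIV. A Z\<^sub>0 $ k' $ k * y $ k') = 0" for k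
        using y by (simp add: vec_eq_iff matrix_vector_mult_def transpose_def)
      have y0: "y $ k = 0" if "k \<notin> K" for k
        using comp[of k] that
        by (simp add: A_def if_distrib[of "\<lambda>x. x * _"] cong: if_cong)
      define v where "v = (\<chi> j. if j \<in> J then y $ inv_into K \<tau> j else 0)"
      have v: "v \<in> coord_space J"
        by (simp add: v_def coord_space_def)
      have v\<tau>: "v $ \<tau> k = y $ k" if "k \<in> K" for k
        using \<tau> that by (auto simp: v_def bij_betw_def)
      have K0: "(N Z\<^sub>0 *v v) $ k = 0" if "k \<in> K" for k
      proof -
        have "(N Z\<^sub>0 *v v) $ k = (\<Sum>k'\<in>K. A Z\<^sub>0 $ k' $ k * y $ k')"
          using that by (simp add: N_mult[OF v] v\<tau> A_def)
        also have "\<dots> = (\<Sum>k'\<in>UNIV. A Z\<^sub>0 $ k' $ k * y $ k')"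
          by (rule sum.mono_neutral_left) (auto simp: y0)
        finally show ?thesis by (simp add: comp)
      qed
      have "N Z\<^sub>0 *v v \<in> graph_plane K W\<^sub>0"
        using v image[of Z\<^sub>0] K(1) J(2) by auto
      then have "(N Z\<^sub>0 *v v) $ i = 0" for i
        using K0 by (cases "i \<in> K") (simp_all add: graph_plane_def)
      then have "M *v (graph_matrix J Z\<^sub>0 *v v) = M *v 0"
        by (simp add: vec_eq_iff N_def matrix_vector_mul_assoc)
      then have "v = 0"
        using graph_matrix_mult_eq_0[OF v] injD[OF M] by blast
      then have "y $ k = 0" for k
        using v\<tau>[of k] y0[of k] by (cases "k \<in> K") simp_all
      then show ?thesis by (simp add: vec_eq_iff)
    qed
    then have "invertible (transpose (A Z\<^sub>0))"
      by (simp add: invertible_left_inverse matrix_left_invertible_ker)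
    then show ?thesis
      by (simp add: invertible_det_nz)
  qed
  have N_diff: "complex_differentiable_within (\<lambda>Z. N Z $ i $ j) Z V" for i j Z V
  proof -
    have "complex_differentiable_within (\<lambda>Z. graph_matrix J Z $ a $ c) Z V" for a c
      unfolding graph_matrix_def by (cases "c \<in> J"; cases "a \<in> J") auto
    then show ?thesis
      unfolding N_def matrix_matrix_mult_def
      by (auto intro!: complex_differentiable_sum complex_differentiable_mult)
  qed
  have A_diff: "complex_differentiable_within (\<lambda>Z. A Z $ i $ j) Z V" for i j Z V
    unfolding A_def by (cases "i \<in> K \<and> j \<in> K") (auto simp: N_diff)
  have b_diff: "complex_differentiable_within (\<lambda>Z. b Z i $ j) Z V" for i j Z V
    unfolding b_def by (cases "j \<in> K") (auto simp: N_diff)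
  have "open {Z. det (A Z) \<noteq> 0}"
    by (intro open_Collect_neq continuous_on_const complex_differentiable_imp_continuous_on
        complex_differentiable_det A_diff)
  then have U_open: "openin (top_of_set (chart_space J)) U"
    unfolding U_def using open_graph_plane_in_Dpq[of J] J(3) by (intro openin_open_Int open_Int) simp_all
  have chart: "(gr_chart K \<circ> f \<circ> graph_plane J) Z = W Z" if "Z \<in> U" for Z
    using that W_chart by (simp add: U_def f W_eq gr_chart_graph_plane)
  have "complex_differentiable_within (\<lambda>Z. (gr_chart K \<circ> f \<circ> graph_plane J) Z $ p) Z U"
    if Z: "Z \<in> U" for Z p
  proof -
    have "complex_differentiable_within (\<lambda>Z. x Z i $ k) Z U" for i k
    proof -
      have entry: "complex_differentiable_within
          (\<lambda>Z. (\<chi> a c. if c = k then b Z i $ a else A Z $ a $ c) $ a $ c) Z U" for a c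
        by (cases "c = k") (simp_all add: A_diff b_diff)
      show ?thesis
        unfolding x_def divide_inverse vec_lambda_beta using Z
        by (intro complex_differentiable_mult complex_differentiable_inverse
            complex_differentiable_det entry A_diff) (simp add: U_def)
    qed
    then have "complex_differentiable_within (\<lambda>Z. W Z $ p) Z U"
      unfolding W_def by (cases "fst p \<notin> K \<and> snd p \<in> K") auto
    then show ?thesis
      unfolding complex_differentiable_within_def
      using Z chart by (metis (no_types, lifting) has_derivative_transform)
  qed
  then have "multi_holomorphic_on (gr_chart K \<circ> f \<circ> graph_plane J) U"
    by (rule multi_holomorphic_onI)
  moreover have "P \<in> graph_plane J ` U"
    using P J det_nz by (auto simp: U_def)
  moreover have "f ` graph_plane J ` U \<subseteq> graph_plane K ` chart_space K"
    using W_chart by (auto simp: U_def f W_eq)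
  moreover have "graph_plane J ` U \<subseteq> Dpq r"
    by (auto simp: U_def)
  ultimately show "\<exists>J K U. card J = r \<and> card K = r \<and>
      openin (top_of_set (chart_space J)) U \<and>
      P \<in> graph_plane J ` U \<and> graph_plane J ` U \<subseteq> Dpq r \<and>
      f ` graph_plane J ` U \<subseteq> graph_plane K ` chart_space K \<and>
      multi_holomorphic_on (gr_chart K \<circ> f \<circ> graph_plane J) U"
    using J(3) K(2) U_open by blast
qed

section \<open>Positive planes\<close>

lemma herm_sq_zero [simp]: "herm_sq 0 = 0"
  by (simp add: herm_sq_eq_inner)

text \<open>With \<open>z = (x, y)\<close>, the plane is the graph of the rank-one map that sends
  \<open>x\<close> to \<open>y\<close> and kills the orthogonal complement of \<open>x\<close>. Its
  norm is \<open>sqrt (Y / X) < 1\<close>, so the graph is positive.\<close>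

lemma positive_subspace_through:
  fixes z :: "complex ^ ('p::finite + 'q::finite)"
  assumes "herm_sq z > 0"
  obtains Q where "Q \<in> Dpq CARD('p)" "z \<in> Q"
proof -
  define X where "X = (\<Sum>a\<in>UNIV. (cmod (z $ Inl a))\<^sup>2)"
  define Y where "Y = (\<Sum>b\<in>UNIV. (cmod (z $ Inr b))\<^sup>2)"
  have "Y \<ge> 0" and "Y < X"
    using assms by (simp_all add: X_def Y_def herm_sq_eq_sums sum_nonneg)
  then have X: "X > 0" by simp
  define J :: "('p + 'q) set" where "J = range Inl"
  have J: "card J = CARD('p)"
    by (simp add: J_def card_image)
  define Z :: "complex ^ (('p + 'q) \<times> ('p + 'q))" where
    "Z = (\<chi> p. z $ fst p * cnj (z $ snd p) / of_real X)"
  have sum_J: "(\<Sum>j\<in>J. F j) = (\<Sum>a\<in>UNIV. F (Inl a))" for F :: "'p + 'q \<Rightarrow> complex"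
    by (simp add: J_def sum.reindex)
  have Z_sum: "(\<Sum>j\<in>J. Z $ (i, j) * u $ j) = z $ i * (\<Sum>a\<in>UNIV. cnj (z $ Inl a) * u $ Inl a) / of_real X"
    for i u
    by (simp add: sum_J Z_def sum_distrib_left sum_divide_distrib mult.assoc)
  have zz: "(\<Sum>a\<in>UNIV. cnj (z $ Inl a) * z $ Inl a) = of_real X"
    by (simp add: X_def complex_norm_square mult.commute del: of_real_power)
  have "z \<in> graph_plane J Z"
    using X by (simp add: graph_plane_def Z_sum zz)
  moreover have "herm_sq u > 0" if u: "u \<in> graph_plane J Z" "u \<noteq> 0" for u
  proof -
    define V where "V = (\<Sum>a\<in>UNIV. (cmod (u $ Inl a))\<^sup>2)"
    define s where "s = (\<Sum>a\<in>UNIV. cnj (z $ Inl a) * u $ Inl a)"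
    have ub: "u $ Inr b = z $ Inr b * s / of_real X" for b
    proof -
      have "Inr b \<in> - J"
        by (auto simp: J_def)
      then show ?thesis
        using u(1) by (simp add: graph_plane_def Z_sum s_def)
    qed
    \<comment> \<open>If the first \<open>p\<close> coordinates of \<open>u\<close> vanish, then
      \<open>s = 0\<close> and by \<open>ub\<close> the others vanish too.\<close>
    have "V \<noteq> 0"
    proof
      assume "V = 0"
      then have ua: "u $ Inl a = 0" for a
        by (simp add: V_def sum_nonneg_eq_0_iff)
      then have "u $ i = 0" for i
        by (cases i) (simp_all add: ub s_def)
      then show False
        using u(2) by (simp add: vec_eq_iff)
    qed
    then have V: "V > 0"
      by (simp add: V_def order.not_eq_order_implies_strict sum_nonneg)
    \<comment> \<open>Cauchy-Schwarz bounds the negative part of \<open>u\<close> by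
      \<open>Y * V / X\<close>, which is less than \<open>V\<close>.\<close>
    have "cmod s \<le> (\<Sum>a\<in>UNIV. \<bar>cmod (z $ Inl a)\<bar> * \<bar>cmod (u $ Inl a)\<bar>)"
      unfolding s_def by (rule sum_norm_le) (simp add: norm_mult)
    also have "\<dots> \<le> sqrt X * sqrt V"
      unfolding X_def V_def L2_set_def[symmetric] by (rule L2_set_mult_ineq)
    finally have "(cmod s)\<^sup>2 \<le> (sqrt X * sqrt V)\<^sup>2"
      by (rule power_mono) simp
    then have s: "(cmod s)\<^sup>2 \<le> X * V"
      using X V by (simp add: power_mult_distrib)
    have "(\<Sum>b\<in>UNIV. (cmod (u $ Inr b))\<^sup>2) = Y * (cmod s)\<^sup>2 / X\<^sup>2"
      by (simp add: ub Y_def norm_mult norm_divide power_mult_distrib power_divide sum_distrib_right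
          sum_divide_distrib)
    also have "\<dots> \<le> Y * (X * V) / X\<^sup>2"
      by (intro divide_right_mono mult_left_mono s \<open>Y \<ge> 0\<close>) simp
    also have "\<dots> < V"
      using mult_strict_right_mono[OF \<open>Y < X\<close> V] X by (simp add: power2_eq_square field_simps)
    finally show ?thesis
      by (simp add: herm_sq_eq_sums V_def)
  qed
  ultimately show ?thesis
    using that[of "graph_plane J Z"]
    by (simp add: Dpq_def Grassmannian_def subspace_graph_plane dim_graph_plane J)
qed

text \<open>Extend \<open>z\<close> to a basis of a positive \<open>p\<close>-plane and keep
  \<open>r\<close> of its vectors, \<open>z\<close> among them; subspaces of positive planes are
  positive.\<close>

lemma positive_plane_through:
  fixes z :: "complex ^ ('p::finite + 'q::finite)"
  assumes "herm_sq z > 0" "1 \<le> r" "r \<le> CARD('p)"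
  obtains P where "P \<in> Dpq r" "z \<in> P"
proof -
  obtain Q where Q: "Q \<in> Dpq CARD('p)" "z \<in> Q"
    using positive_subspace_through assms(1) by blast
  then have Q': "vec.subspace Q" "vec.dim Q = CARD('p)"
    by (auto simp: Dpq_def Grassmannian_def)
  have "z \<noteq> 0"
    using assms(1) by auto
  then have "vec.independent {z}"
    by simp
  then obtain B where B: "{z} \<subseteq> B" "B \<subseteq> Q" "vec.independent B" "Q \<subseteq> vec.span B"
    using vec.maximal_independent_subset_extend[of "{z}" Q] Q(2) by blast
  have "card B = CARD('p)"
    using B Q' by (metis vec.basis_card_eq_dim)
  then obtain C where C: "{z} \<subseteq> C" "C \<subseteq> B" "card C = r"
    using exists_subset_between[of "{z}" r B] B assms vec.finiteI_independent[OF B(3)] by auto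
  have "vec.independent C"
    using B(3) C(2) by (rule vec.independent_mono)
  then have "vec.dim (vec.span C) = r"
    using C(3) vec.dim_span_eq_card_independent by blast
  moreover have "vec.span C \<subseteq> Q"
    using B(2) C(2) Q'(1) by (metis order_trans vec.span_minimal)
  ultimately have "vec.span C \<in> Dpq r"
    using Q(1) by (auto simp: Dpq_def Grassmannian_def)
  then show ?thesis
    using that C(1) vec.span_base by blast
qed

lemma herm_sq_axis_Inl: "herm_sq (axis (Inl a) c) = (cmod c)\<^sup>2"
  and herm_sq_axis_Inr: "herm_sq (axis (Inr b) c) = - (cmod c)\<^sup>2"
  by (simp_all add: herm_sq_eq_sums axis_def if_distrib[of cmod] if_distrib[of "\<lambda>x. x\<^sup>2"] cong: if_cong)

text \<open>Every \<open>z\<close> is the difference of \<open>z + t e\<close> and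
  \<open>t e\<close>, both positive when \<open>e\<close> is positive and \<open>t\<close> is
  large.\<close>

lemma subspace_containing_positive_vectors:
  fixes S :: "(complex ^ ('p::finite + 'q::finite)) set"
  assumes S: "vec.subspace S" and pos: "\<And>z. herm_sq z > 0 \<Longrightarrow> z \<in> S"
  shows "S = UNIV"
proof -
  fix a :: 'p
  define e :: "complex ^ ('p + 'q)" where "e = axis (Inl a) 1"
  have e: "herm_sq e = 1"
    by (simp add: e_def herm_sq_axis_Inl)
  have "z \<in> S" for z
  proof -
    define h where "h = z \<bullet> (Hpq *v e)"
    define m where "m = \<bar>herm_sq z\<bar>"
    \<comment> \<open>Chosen so that \<open>t\<^sup>2 - 2 * \<bar>h\<bar> * t = t * (m + 1)\<close>,
      which exceeds \<open>- herm_sq z\<close>.\<close>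
    define t where "t = m + 2 * \<bar>h\<bar> + 1"
    have m: "m \<ge> 0" "- herm_sq z \<le> m"
      by (simp_all add: m_def)
    then have t: "t \<ge> 1"
      by (simp add: t_def)
    have "2 * h * t \<ge> - (2 * \<bar>h\<bar> * t)"
      using mult_right_mono[of "- \<bar>h\<bar>" h t] t by linarith
    moreover have "t\<^sup>2 - 2 * \<bar>h\<bar> * t = t * (m + 1)"
      by (simp add: t_def algebra_simps power2_eq_square)
    moreover have "t * (m + 1) \<ge> m + 1"
      using mult_right_mono[OF t, of "m + 1"] m by simp
    moreover have "herm_sq (z + t *\<^sub>R e) = herm_sq z + 2 * h * t + t\<^sup>2"
      using self_adjoint.quad_add[OF self_adjoint_Hpq, of z t e] e
      by (simp add: herm_sq_eq_inner h_def)
    ultimately have "herm_sq (z + t *\<^sub>R e) > 0"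
      using m by linarith
    then have "z + t *\<^sub>R e \<in> S" "t *\<^sub>R e \<in> S"
      using pos e vec.subspace_scale[OF S] by (auto simp: scaleR_eq_of_real_smult)
    then show ?thesis
      using vec.subspace_diff[OF S] by fastforce
  qed
  then show ?thesis by auto
qed

section \<open>Automorphisms and the normalization of the representing matrix\<close>

lemma gr_automorphism_if_invertible:
  fixes M :: "complex ^ ('p::finite + 'q::finite) ^ ('p + 'q)"
  assumes M: "invertible M" and f: "\<And>P. P \<in> Dpq r \<Longrightarrow> f P = (*v) M ` P"
    and surj: "f ` Dpq r = Dpq r"
  shows "gr_automorphism r f (Dpq r)"
proof -
  obtain M' where M': "M ** M' = mat 1" "M' ** M = mat 1"
    using M by (auto simp: invertible_def)
  have inv: "M' *v (M *v z) = z" "M *v (M' *v z) = z" for z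
    by (simp_all add: matrix_vector_mul_assoc M')
  have inj: "inj ((*v) M)" "inj ((*v) M')"
    by (metis injI inv)+
  have "inj_on f (Dpq r)"
    by (rule inj_onI) (simp add: f inj_image_eq_iff[OF inj(1)])
  then have bij: "bij_betw f (Dpq r) (Dpq r)"
    using surj by (simp add: bij_betw_def)
  \<comment> \<open>The inverse map is induced by the inverse matrix, so the holomorphy lemma
    applies to both directions.\<close>
  have "inv_into (Dpq r) f P = (*v) M' ` P" if "P \<in> Dpq r" for P
  proof -
    have "P \<in> f ` Dpq r"
      using that by (simp only: surj)
    then obtain Q where Q: "Q \<in> Dpq r" "P = f Q"
      by blast
    then have "inv_into (Dpq r) f P = Q"
      using \<open>inj_on f (Dpq r)\<close> by simp
    then show ?thesis
      by (simp add: Q f image_image inv)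
  qed
  then show ?thesis
    unfolding gr_automorphism_def
    by (intro conjI bij gr_holomorphic_on_invertible[OF inj(1) f]
        gr_holomorphic_on_invertible[OF inj(2)])
qed

theorem theorem2p5:
  fixes r :: nat
    and f :: "(complex ^ ('p::finite + 'q::finite)) set \<Rightarrow> (complex ^ ('p + 'q)) set"
  assumes "1 \<le> r" and "r \<le> CARD('p)"
    and "linear_self_map r f"
    and "f ` Dpq r = Dpq r"
  shows "(\<exists>M. represents r M f \<and> hermitian_transpose M ** Hpq ** M = Hpq)
    \<and> gr_automorphism r f (Dpq r)"
proof -
  obtain M where "represents r M f"
    using assms(3) by (auto simp: linear_self_map_def)
  then have f: "f P = (*v) M ` P" if "P \<in> Dpq r" for P
    using that by (simp add: represents_def)
  \<comment> \<open>Surjectivity enters here: a positive plane through \<open>w\<close> is the image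
    of a positive plane, and the preimage of \<open>w\<close> in it is nonzero because
    \<open>w\<close> is.\<close>
  have pre: "\<exists>z. herm_sq z > 0 \<and> M *v z = w" if w: "herm_sq w > 0" for w
  proof -
    obtain Q where "Q \<in> Dpq r" "w \<in> Q"
      using positive_plane_through[OF w assms(1,2)] by blast
    then obtain P z where "P \<in> Dpq r" "z \<in> P" "M *v z = w"
      using assms(4) f by (metis (no_types, lifting) imageE)
    then show ?thesis
      using w by (intro exI[of _ z]) (auto simp: Dpq_def)
  qed
  have "range ((*v) M) = UNIV"
    by (rule subspace_containing_positive_vectors)
      (use pre in \<open>auto intro!: vec.linear_subspace_image[OF matrix_vector_mul_linear_gen]\<close>)
  then have M: "invertible M"
    by (simp add: invertible_right_inverse matrix_right_invertible_surjective)
  then have inj: "inj ((*v) M)"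
    by (simp add: invertible_left_inverse matrix_left_invertible_injective)
  have pos: "herm_sq z > 0 \<longleftrightarrow> herm_sq (M *v z) > 0" for z
  proof
    assume z: "herm_sq z > 0"
    then obtain P where P: "P \<in> Dpq r" "z \<in> P"
      using positive_plane_through[OF z assms(1,2)] by blast
    then have "M *v z \<in> f P" "f P \<in> Dpq r"
      using f assms(4) by auto
    moreover have "M *v z \<noteq> 0"
      using z injD[OF inj, of z 0] by auto
    ultimately show "herm_sq (M *v z) > 0"
      by (auto simp: Dpq_def)
  next
    assume "herm_sq (M *v z) > 0"
    then show "herm_sq z > 0"
      using pre injD[OF inj] by blast
  qed
  \<comment> \<open>As \<open>p, q \<ge> 1\<close>, there are coordinate vectors of both signs,
    which makes the form indefinite.\<close>
  fix a :: 'p and b :: 'q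
  obtain c where c: "c > 0"
    "\<And>z. (hermitian_transpose M ** Hpq ** M) *v z = c *\<^sub>R (Hpq *v z)"
  proof (rule same_positive_cone_imp_proportional[OF self_adjoint_Hpq self_adjoint_congruence])
    show "axis (Inl a) 1 \<bullet> (Hpq *v axis (Inl a) 1) > 0"
      by (simp flip: herm_sq_eq_inner add: herm_sq_axis_Inl)
    show "axis (Inr b) 1 \<bullet> (Hpq *v axis (Inr b) 1) < 0"
      by (simp flip: herm_sq_eq_inner add: herm_sq_axis_Inr)
    show "z \<bullet> (Hpq *v z) > 0 \<longleftrightarrow> z \<bullet> ((hermitian_transpose M ** Hpq ** M) *v z) > 0" for z
      unfolding inner_congruence herm_sq_eq_inner[symmetric] by (rule pos)
  qed (rule that)
  \<comment> \<open>Both factors \<open>M\<close> of the congruence contribute a \<open>k\<close>,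
    so \<open>k * k\<close> cancels \<open>c\<close>.\<close>
  define k where "k = inverse (sqrt c)"
  have k: "k \<noteq> 0" "k * k * c = 1"
    using c(1) by (simp_all add: k_def field_simps)
  define N where "N = k *\<^sub>R M"
  have N: "N *v z = k *\<^sub>R (M *v z)" for z
    by (simp add: N_def vec_eq_iff matrix_vector_mult_def scaleR_sum_right)
  have Nt: "hermitian_transpose N *v z = k *\<^sub>R (hermitian_transpose M *v z)" for z
    by (simp add: N_def vec_eq_iff matrix_vector_mult_def scaleR_sum_right hermitian_transpose_def
        map_matrix_def transpose_def)
  have "(hermitian_transpose N ** Hpq ** N) *v z = Hpq *v z" for z
  proof -
    have "(hermitian_transpose N ** Hpq ** N) *v z = hermitian_transpose N *v (Hpq *v (N *v z))"
      by (simp add: matrix_vector_mul_assoc matrix_mul_assoc)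
    also have "\<dots> = (k * k) *\<^sub>R ((hermitian_transpose M ** Hpq ** M) *v z)"
      unfolding N Nt matrix_vector_mult_scaleR
      by (simp add: matrix_vector_mul_assoc matrix_mul_assoc)
    also have "\<dots> = Hpq *v z"
      by (simp add: c(2) k(2))
    finally show ?thesis .
  qed
  then have "hermitian_transpose N ** Hpq ** N = Hpq"
    by (simp add: matrix_eq)
  moreover have "represents r N f"
    unfolding represents_def
  proof (intro conjI allI impI ballI)
    fix z assume "N *v z = 0"
    then show "herm_sq z \<le> 0"
      using k(1) injD[OF inj, of z 0] by (simp add: N)
  next
    fix P :: "(complex ^ ('p + 'q)) set" assume P: "P \<in> Dpq r"
    then have "vec.subspace P"
      by (simp add: Dpq_def Grassmannian_def)
    then have scale: "a *\<^sub>R z \<in> P" if "z \<in> P" for a z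
      using that by (simp add: scaleR_eq_of_real_smult vec.subspace_scale)
    \<comment> \<open>A nonzero scalar preserves every subspace, so \<open>N\<close> and
      \<open>M\<close> induce the same map on planes.\<close>
    have "(*\<^sub>R) k ` P = P"
    proof (intro equalityI subsetI)
      fix z assume "z \<in> P"
      then show "z \<in> (*\<^sub>R) k ` P"
        using k(1) by (intro image_eqI[of _ _ "inverse k *\<^sub>R z"] scale) simp_all
    qed (use scale in auto)
    moreover have "(*v) N ` P = (*v) M ` (*\<^sub>R) k ` P"
      by (simp add: image_image N matrix_vector_mult_scaleR)
    ultimately show "f P = (*v) N ` P"
      by (simp add: f P)
  qed
  ultimately show ?thesis
    using gr_automorphism_if_invertible[OF M f assms(4)] by blast
qed

end
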